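(* Let $r\ge 5$ be a fixed prime. Then there is a constant $c_r>0$ depending only on $r$ such that, for every sufficiently large prime $q$ with $q\equiv\pm1\pmod r$, $$\operatorname{IM}(2,q)\ge c_r\, q^{\frac32-\frac{2}{r-1}}.$$
   Context: For a prime power $q$, $\operatorname{IM}(2,q)$ denotes the largest $n$ for which there exist points $p_1,\dots,p_n\in\mathbb{F}_q^2$ and affine lines $\ell_1,\dots,\ell_n\subset\mathbb{F}_q^2$ such that, for all $i,j$, $p_i\in\ell_j$ if and only if $i=j$. "Sufficiently large" may depend on $r$. *)

theory Defs
  imports Complex_Main "HOL-Number_Theory.Residues"
begin

definition plane :: "('a, 'b) ring_scheme \<Rightarrow> ('a \<times> 'a) set" where
  "plane F = carrier F \<times> carrier F"

definition affine_line :: "('a, 'b) ring_scheme \<Rightarrow> ('a \<times> 'a) set \<Rightarrow> bool" where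
  "affine_line F L \<longleftrightarrow>
     (\<exists>a\<in>carrier F. \<exists>b\<in>carrier F. \<exists>c\<in>carrier F.
        (a, b) \<noteq> (\<zero>\<^bsub>F\<^esub>, \<zero>\<^bsub>F\<^esub>) \<and>
        L = {(x, y) \<in> plane F. a \<otimes>\<^bsub>F\<^esub> x \<oplus>\<^bsub>F\<^esub> b \<otimes>\<^bsub>F\<^esub> y = c})"

definition induced_matching ::
    "('a, 'b) ring_scheme \<Rightarrow> nat \<Rightarrow> (nat \<Rightarrow> 'a \<times> 'a) \<Rightarrow> (nat \<Rightarrow> ('a \<times> 'a) set) \<Rightarrow> bool" where
  "induced_matching F n p l \<longleftrightarrow>
     (\<forall>i<n. p i \<in> plane F) \<and> (\<forall>j<n. affine_line F (l j)) \<and>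
     (\<forall>i<n. \<forall>j<n. p i \<in> l j \<longleftrightarrow> i = j)"

(* Max is meaningful here because the points of an induced matching are pairwise distinct,
   so that n is at most the number of points of the plane; see induced_matching_le. *)
definition IM2 :: "('a, 'b) ring_scheme \<Rightarrow> nat" where
  "IM2 F = Max {n. \<exists>p l. induced_matching F n p l}"

lemma induced_matching_le:
  assumes "finite (carrier F)" and "induced_matching F n p l"
  shows "n \<le> card (plane F)"
proof -
  have "inj_on p {..<n}"
    using assms(2) unfolding induced_matching_def inj_on_def by (metis lessThan_iff)
  moreover have "p ` {..<n} \<subseteq> plane F"
    using assms(2) by (auto simp: induced_matching_def)
  moreover have "finite (plane F)"
    using assms(1) by (simp add: plane_def)
  ultimately show ?thesis
    using card_inj_on_le by fastforce
qed

lemma finite_induced_matching_sizes: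
  assumes "finite (carrier F)"
  shows "finite {n. \<exists>p l. induced_matching F n p l}"
  by (rule finite_subset[of _ "{..card (plane F)}"]) (auto dest: induced_matching_le[OF assms])

end

theory Submission
  imports Defs "HOL-Computational_Algebra.Polynomial"
begin

text \<open>
  Let \<open>d = (r - 1)/2\<close>. The real cyclotomic field of degree \<open>d\<close> generated by \<open>2 cos (2\<pi>/r)\<close> is totally
  real, and since \<open>q \<equiv> \<plusminus>1 (mod r)\<close> the minimal polynomial \<open>\<Psi>\<close> of this number has a root \<open>b\<close>
  modulo \<open>q\<close>; evaluation at \<open>b\<close> is a ring homomorphism from the integers of the field to the
  residue field. For integers \<open>x, k\<close> of the field take the point \<open>(x, x\<^sup>2 + k)\<close> and the line of slope
  \<open>2 x\<close> through it. The point of \<open>(x, k)\<close> lies on the line of \<open>(x', k')\<close> iff \<open>(x - x')\<^sup>2 + k - k'\<close>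
  vanishes modulo \<open>q\<close>. If all conjugates of \<open>x\<close> and \<open>k\<close> are at most small multiples of \<open>q\<close> to the
  powers \<open>1/(2 d)\<close> and \<open>1/d\<close>, this element has norm smaller than \<open>q\<close> in absolute value, so it
  vanishes modulo \<open>q\<close> only if it is \<open>0\<close>. Then \<open>k' - k\<close> is a square and hence nonnegative
  in every real embedding; if only \<open>k\<close> of trace \<open>0\<close> are used, this forces \<open>k = k'\<close> and \<open>x = x'\<close>.
  There are about \<open>q\<close> to the power \<open>1/2\<close> choices of \<open>x\<close> and \<open>q\<close> to the power \<open>(d - 1)/d\<close> of \<open>k\<close>.
\<close>

section \<open>Chebyshev-type recurrences\<close>

fun lucas :: "'a::comm_ring_1 \<Rightarrow> 'a \<Rightarrow> 'a \<Rightarrow> nat \<Rightarrow> 'a" where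
  "lucas a b x 0 = a"
| "lucas a b x (Suc 0) = b"
| "lucas a b x (Suc (Suc n)) = x * lucas a b x (Suc n) - lucas a b x n"

text \<open>If \<open>x = z + 1/z\<close>, then \<open>V x n = z\<^sup>n + 1/z\<^sup>n\<close>, and \<open>U x n\<close> and \<open>W x n\<close> are
  the sums of \<open>z\<^sup>k\<close> over \<open>k = n, n - 2, \<dots>, -n\<close> and over \<open>k = n, n - 1, \<dots>, -n\<close>.\<close>

abbreviation V :: "'a::comm_ring_1 \<Rightarrow> nat \<Rightarrow> 'a" where "V x \<equiv> lucas 2 x x"
abbreviation U :: "'a::comm_ring_1 \<Rightarrow> nat \<Rightarrow> 'a" where "U x \<equiv> lucas 1 x x"
abbreviation W :: "'a::comm_ring_1 \<Rightarrow> nat \<Rightarrow> 'a" where "W x \<equiv> lucas 1 (x + 1) x"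

text \<open>With \<open>x = z + 1/z\<close> this expands (z^(m+n) + z^-(m+n))(z^n + z^-n). The shape
  of the indices avoids truncated subtraction; the induction uses its hypotheses at shifted
  \<open>m\<close>.\<close>

lemma V_mult: "V x (m + n) * V x n = V x (m + 2 * n) + V x m"
proof (induction n arbitrary: m rule: induct_nat_012)
  case (ge2 n)
  have 1: "V x (Suc m + Suc n) * V x (Suc n) = V x (Suc (m + 2 * n) + 2) + V x (Suc m)"
    using ge2(2)[of "Suc m"] by (simp add: algebra_simps)
  have 2: "V x (Suc (Suc m) + n) * V x n = V x (m + 2 * n + 2) + V x (Suc (Suc m))"
    using ge2(1)[of "Suc (Suc m)"] by (simp add: algebra_simps)
  have "V x (m + Suc (Suc n)) * V x (Suc (Suc n))
      = x * (V x (Suc m + Suc n) * V x (Suc n)) - V x (Suc (Suc m) + n) * V x n"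
    by (simp add: algebra_simps)
  also have "\<dots> = V x (m + 2 * Suc (Suc n)) + V x m"
    unfolding 1 2 by (simp add: algebra_simps)
  finally show ?case .
qed (auto simp: algebra_simps)

lemma V_double: "V x (2 * n) = (V x n)\<^sup>2 - 2"
  using V_mult[of x 0 n] by (simp add: power2_eq_square algebra_simps)

text \<open>Replacing z by z^n turns \<open>x\<close> into \<open>V x n\<close>.\<close>

lemma V_V: "V (V x n) m = V x (m * n)"
proof (induction m rule: induct_nat_012)
  case (ge2 m)
  have "V x (n + m * n) * V x n = V x (n + (n + m * n)) + V x (m * n)"
    using V_mult[of x "m * n" n] by (simp add: add_ac mult_2)
  then show ?case using ge2 by (simp add: mult.commute)
qed auto

lemma V_two [simp]: "V 2 n = 2"
  by (induction n rule: induct_nat_012) auto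

lemma W_two: "W 2 n = 2 * of_nat n + 1"
  by (induction n rule: induct_nat_012) (auto simp: algebra_simps)

text \<open>Both sides are (z^(n+1) - z^-(n+1))^2, since \<open>x\<^sup>2 - 4\<close> is (z -
  1/z)^2. The recurrence has order two, so three neighbouring identities go through the induction
  together.\<close>

lemma V_even_eq: "V x (2 * n + 2) - 2 = (x\<^sup>2 - 4) * (U x n)\<^sup>2"
proof -
  have "V x (2 * n + 2) - 2 = (x\<^sup>2 - 4) * (U x n)\<^sup>2 \<and>
        V x (2 * n + 3) - x = (x\<^sup>2 - 4) * (U x n * U x (Suc n)) \<and>
        V x (2 * n + 4) - 2 = (x\<^sup>2 - 4) * (U x (Suc n))\<^sup>2"
  proof (induction n)
    case 0
    show ?case by (simp add: numeral_eq_Suc algebra_simps)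
  next
    case (Suc n)
    define v where "v i = V x (2 * n + i)" for i
    have v: "v 4 = x * v 3 - v 2" "v 5 = x * v 4 - v 3" "v 6 = x * v 5 - v 4"
      by (simp_all add: v_def numeral_eq_Suc)
    have u: "U x (Suc (Suc n)) = x * U x (Suc n) - U x n" by simp
    have IH: "v 2 - 2 = (x\<^sup>2 - 4) * (U x n)\<^sup>2"
      "v 3 - x = (x\<^sup>2 - 4) * (U x n * U x (Suc n))"
      "v 4 - 2 = (x\<^sup>2 - 4) * (U x (Suc n))\<^sup>2"
      using Suc.IH by (simp_all add: v_def)
    have "v 5 - x = x * (v 4 - 2) - (v 3 - x)"
      unfolding v(2) by (simp add: algebra_simps)
    then have 1: "v 5 - x = (x\<^sup>2 - 4) * (U x (Suc n) * U x (Suc (Suc n)))"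
      unfolding IH u by (simp add: algebra_simps power2_eq_square)
    have "v 2 = x * v 3 - v 4" using v(1) by simp
    then have "v 6 - 2 = x\<^sup>2 * (v 4 - 2) - 2 * x * (v 3 - x) + (v 2 - 2)"
      unfolding v(2,3) by (simp add: algebra_simps power2_eq_square)
    then have 2: "v 6 - 2 = (x\<^sup>2 - 4) * (U x (Suc (Suc n)))\<^sup>2"
      unfolding IH u by (simp add: algebra_simps power2_eq_square)
    have "2 * Suc n + 2 = 2 * n + 4" "2 * Suc n + 3 = 2 * n + 5" "2 * Suc n + 4 = 2 * n + 6"
      by simp_all
    then show ?case using 1 2 IH(3) by (simp only: v_def)
  qed
  then show ?thesis by blast
qed

text \<open>The same factorization at half-integer exponents: \<open>x - 2\<close> is (z^(1/2) -
  z^(-1/2))^2.\<close>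

lemma V_odd_eq: "V x (2 * n + 1) - 2 = (x - 2) * (W x n)\<^sup>2"
proof -
  have "V x (2 * n + 1) - 2 = (x - 2) * (W x n)\<^sup>2 \<and>
        V x (2 * n + 2) - x = (x - 2) * (W x n * W x (Suc n)) \<and>
        V x (2 * n + 3) - 2 = (x - 2) * (W x (Suc n))\<^sup>2"
  proof (induction n)
    case 0
    show ?case by (simp add: numeral_eq_Suc algebra_simps)
  next
    case (Suc n)
    define v where "v i = V x (2 * n + i)" for i
    have v: "v 3 = x * v 2 - v 1" "v 4 = x * v 3 - v 2" "v 5 = x * v 4 - v 3"
      by (simp_all add: v_def numeral_eq_Suc)
    have u: "W x (Suc (Suc n)) = x * W x (Suc n) - W x n" by simp
    have IH: "v 1 - 2 = (x - 2) * (W x n)\<^sup>2"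
      "v 2 - x = (x - 2) * (W x n * W x (Suc n))"
      "v 3 - 2 = (x - 2) * (W x (Suc n))\<^sup>2"
      using Suc.IH by (simp_all add: v_def)
    have "v 4 - x = x * (v 3 - 2) - (v 2 - x)"
      unfolding v(2) by (simp add: algebra_simps)
    then have 1: "v 4 - x = (x - 2) * (W x (Suc n) * W x (Suc (Suc n)))"
      unfolding IH u by (simp add: algebra_simps power2_eq_square)
    have "v 1 = x * v 2 - v 3" using v(1) by simp
    then have "v 5 - 2 = x\<^sup>2 * (v 3 - 2) - 2 * x * (v 2 - x) + (v 1 - 2)"
      unfolding v(2,3) by (simp add: algebra_simps power2_eq_square)
    then have 2: "v 5 - 2 = (x - 2) * (W x (Suc (Suc n)))\<^sup>2"
      unfolding IH u by (simp add: algebra_simps power2_eq_square)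
    have "2 * Suc n + 1 = 2 * n + 3" "2 * Suc n + 2 = 2 * n + 4" "2 * Suc n + 3 = 2 * n + 5"
      by simp_all
    then show ?case using 1 2 IH(3) by (simp only: v_def)
  qed
  then show ?thesis by blast
qed

text \<open>Meant for \<open>n = q - 1\<close>: for an integer x modulo an odd prime q,
  \<open>V x q\<close> is x, so the right side vanishes and one of \<open>V x (q + 1)\<close>,
  \<open>V x (q - 1)\<close> is 2.\<close>

lemma V_neighbours: "(V x (Suc (Suc n)) - 2) * (V x n - 2) = (V x (Suc n) - x)\<^sup>2"
proof -
  have "V x (2 + n) * V x n = V x (2 * Suc n) + V x 2"
    using V_mult[of x 2 n] by (simp add: algebra_simps)
  then have "V x (Suc (Suc n)) * V x n = (V x (Suc n))\<^sup>2 - 2 + (x\<^sup>2 - 2)"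
    unfolding V_double by (simp add: numeral_eq_Suc)
  moreover have "V x (Suc (Suc n)) = x * V x (Suc n) - V x n" by simp
  moreover have "(V x (Suc (Suc n)) - 2) * (V x n - 2)
      = V x (Suc (Suc n)) * V x n - 2 * (V x (Suc (Suc n)) + V x n) + 4"
    by (simp add: algebra_simps del: lucas.simps)
  ultimately show ?thesis by (simp add: algebra_simps power2_eq_square)
qed

lemma V_cos: "V (2 * cos t) n = 2 * cos (real n * t)"
proof (induction n rule: induct_nat_012)
  case (ge2 n)
  have "cos (real (Suc (Suc n)) * t) = cos (real (Suc n) * t + t)"
    "cos (real n * t) = cos (real (Suc n) * t - t)"
    by (simp_all add: algebra_simps)
  then show ?case using ge2 by (simp add: cos_add cos_diff del: of_nat_Suc)
qed auto

section \<open>Frobenius congruences\<close>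

lemma sum_choose_prime_cong:
  fixes F :: "nat \<Rightarrow> 'a::comm_ring_1"
  assumes "prime p"
  shows "of_nat p dvd (\<Sum>i\<le>p. of_nat (p choose i) * F i) - (F 0 + F p)"
proof -
  have p: "p > 0" using assms by (rule prime_gt_0_nat)
  have "{..p} = insert 0 (insert p {0<..<p})" using p by auto
  then have "(\<Sum>i\<le>p. of_nat (p choose i) * F i) - (F 0 + F p)
      = (\<Sum>i\<in>{0<..<p}. of_nat (p choose i) * F i)"
    using p by simp
  moreover have "(of_nat p :: 'a) dvd of_nat (p choose i)" if "i \<in> {0<..<p}" for i
    using dvd_choose_prime[of i p] that assms by (auto elim!: dvdE)
  ultimately show ?thesis by (metis (no_types, lifting) dvd_sum dvd_mult2)
qed

text \<open>Expand (z + 1/z)^n and add the same sum reversed by i -> n - i: this pairs z^k with z^-k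
  and doubles the left side.\<close>

lemma power_eq_sum_V: "2 * x ^ n = (\<Sum>i\<le>n. of_nat (n choose i) * V x (nat \<bar>int n - 2 * int i\<bar>))"
proof -
  \<comment> \<open>Extending \<open>V x\<close> evenly to negative indices makes its recurrence
    valid at every integer.\<close>
  define v where "v k = V x (nat \<bar>k\<bar>)" for k :: int
  have v: "x * v k = v (k + 1) + v (k - 1)" for k
  proof -
    have pos: "x * v k = v (k + 1) + v (k - 1)" if "k \<ge> 0" for k
    proof (cases "k = 0")
      case True then show ?thesis by (simp add: v_def)
    next
      case False
      define n where "n = nat (k - 1)"
      have "nat \<bar>k\<bar> = Suc n" "nat \<bar>k + 1\<bar> = Suc (Suc n)" "nat \<bar>k - 1\<bar> = n"
        using that False by (auto simp: n_def)
      then show ?thesis by (simp add: v_def)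
    qed
    have sym: "v (- k) = v k" for k by (simp add: v_def)
    show ?thesis
    proof (cases "k \<ge> 0")
      case False
      then have "x * v (- k) = v (- k + 1) + v (- k - 1)" by (intro pos) simp
      moreover have "- k + 1 = - (k - 1)" "- k - 1 = - (k + 1)" by simp_all
      ultimately show ?thesis by (simp only: sym) (simp add: add_ac)
    qed (rule pos)
  qed
  have "2 * x ^ n = (\<Sum>i\<le>n. of_nat (n choose i) * v (int n - 2 * int i))"
  proof (induction n)
    case 0 then show ?case by (simp add: v_def)
  next
    case (Suc n)
    let ?g = "\<lambda>i. v (int (Suc n) - 2 * int i)"
    have "2 * x ^ Suc n = (\<Sum>i\<le>n. of_nat (n choose i) * (x * v (int n - 2 * int i)))"
      by (simp add: sum_distrib_left algebra_simps flip: Suc.IH)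
         (simp add: Suc.IH sum_distrib_left algebra_simps)
    also have "\<dots> = (\<Sum>i\<le>n. of_nat (n choose i) * ?g i) + (\<Sum>i\<le>n. of_nat (n choose i) * ?g (Suc i))"
      by (simp add: v sum.distrib algebra_simps)
    also have "(\<Sum>i\<le>n. of_nat (n choose i) * ?g i) = ?g 0 + (\<Sum>i\<le>n. of_nat (n choose Suc i) * ?g (Suc i))"
    proof -
      have "(\<Sum>i\<le>n. of_nat (n choose i) * ?g i) = (\<Sum>i\<le>Suc n. of_nat (n choose i) * ?g i)"
        by (simp add: binomial_eq_0)
      also have "\<dots> = ?g 0 + (\<Sum>i\<le>n. of_nat (n choose Suc i) * ?g (Suc i))"
        by (subst sum.atMost_Suc_shift) simp
      finally show ?thesis .
    qed
    also have "?g 0 + (\<Sum>i\<le>n. of_nat (n choose Suc i) * ?g (Suc i)) + (\<Sum>i\<le>n. of_nat (n choose i) * ?g (Suc i))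
        = ?g 0 + (\<Sum>i\<le>n. of_nat (Suc n choose Suc i) * ?g (Suc i))"
      by (simp add: sum.distrib algebra_simps)
    also have "\<dots> = (\<Sum>i\<le>Suc n. of_nat (Suc n choose i) * ?g i)"
      by (subst sum.atMost_Suc_shift[of "\<lambda>i. of_nat (Suc n choose i) * ?g i"]) simp
    finally show ?case .
  qed
  then show ?thesis by (simp add: v_def)
qed

text \<open>In \<open>power_eq_sum_V\<close> only the end terms survive modulo p, and both are
  \<open>V x p\<close>. The factor 2 is cancelled later, for odd primes.\<close>

lemma V_prime_cong:
  assumes "prime p"
  shows "of_nat p dvd 2 * (V x p - x ^ p)"
proof -
  have "of_nat p dvd (\<Sum>i\<le>p. of_nat (p choose i) * V x (nat \<bar>int p - 2 * int i\<bar>)) - (V x p + V x p)"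
    using sum_choose_prime_cong[OF assms, of "\<lambda>i. V x (nat \<bar>int p - 2 * int i\<bar>)"] by simp
  then have "of_nat p dvd 2 * x ^ p - (V x p + V x p)"
    by (simp only: power_eq_sum_V[of x p])
  then have "of_nat p dvd - (2 * x ^ p - (V x p + V x p))"
    by (simp only: dvd_minus_iff)
  then show ?thesis by (simp add: algebra_simps)
qed

lemma freshmans_dream_cong:
  fixes x y :: "'a::comm_ring_1"
  assumes "prime p"
  shows "of_nat p dvd (x + y) ^ p - (x ^ p + y ^ p)"
  using sum_choose_prime_cong[OF assms, of "\<lambda>i. x ^ i * y ^ (p - i)"]
  by (simp add: binomial_ring mult.assoc add.commute)

section \<open>Roots modulo a prime\<close>

abbreviation X :: "int poly" where "X \<equiv> [:0, 1:]"

lemma poly_lucas: "poly (lucas a b c n) t = lucas (poly a t) (poly b t) (poly c t) n"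
  by (induction n rule: induct_nat_012) auto

lemma lucas_X_monic:
  assumes "degree a = 0" "degree b = 1" "lead_coeff b = 1" "n > 0"
  shows "degree (lucas a b X n) = n" "lead_coeff (lucas a b X n) = 1"
proof -
  have deg: "degree (lucas a b X n) \<le> n" for n
  proof (induction n rule: induct_nat_012)
    case (ge2 n)
    have "degree (X * lucas a b X (Suc n)) \<le> Suc (Suc n)"
      using ge2 by (intro order.trans[OF degree_mult_le]) simp
    then show ?case using ge2 by (auto intro!: degree_diff_le)
  qed (use assms in auto)
  have co: "coeff (lucas a b X (Suc n)) (Suc n) = 1" for n
  proof (induction n rule: induct_nat_012)
    case 1
    then show ?case using assms by (simp add: coeff_eq_0)
  next
    case (ge2 n)
    have "coeff (lucas a b X (Suc n)) (Suc (Suc (Suc n))) = 0"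
      using deg[of "Suc n"] by (intro coeff_eq_0) simp
    then show ?case using ge2 by (simp del: lucas.simps add: lucas.simps(3)[of a b X "Suc n"])
  qed (use assms in auto)
  have "coeff (lucas a b X n) n = 1" using co[of "n - 1"] assms by simp
  then show "degree (lucas a b X n) = n" "lead_coeff (lucas a b X n) = 1"
    using deg[of n] le_degree[of "lucas a b X n" n] by auto
qed

text \<open>Lagrange's argument: a root \<open>c\<close> splits off X - c, and primality makes every
  other root a root of the quotient, which is again monic.\<close>

lemma card_roots_mod_prime:
  fixes f :: "int poly" and p :: int
  assumes "prime p" "lead_coeff f = 1"
  shows "card {b \<in> {0..<p}. p dvd poly f b} \<le> degree f"
  using assms(2)
proof (induction "degree f" arbitrary: f)
  case 0
  then have "f = 1" by (metis degree_0_id lead_coeff_1 one_pCons of_int_1 degree_eq_zeroE coeff_pCons_0)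
  then have "{b \<in> {0..<p}. p dvd poly f b} = {}" using assms(1) by (auto simp: not_prime_unit)
  then show ?case by (metis card.empty le0)
next
  case (Suc n)
  show ?case
  proof (cases "\<exists>c\<in>{0..<p}. p dvd poly f c")
    case False
    then have "{b \<in> {0..<p}. p dvd poly f b} = {}" by auto
    then show ?thesis by (metis card.empty le0)
  next
    case True
    then obtain c where c: "c \<in> {0..<p}" "p dvd poly f c" by blast
    define g where "g = synthetic_div f c"
    have dg: "degree g = n" using Suc(2) by (simp add: g_def degree_synthetic_div)
    have "coeff f (Suc n) + c * coeff g (Suc n) = coeff g n"
      using arg_cong[OF synthetic_div_correct[of f c], of "\<lambda>h. coeff h (Suc n)"] by (simp add: g_def)
    then have "lead_coeff g = 1" using dg Suc by (simp add: coeff_eq_0)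
    then have IH: "card {b \<in> {0..<p}. p dvd poly g b} \<le> n" using Suc dg by metis
    have "{b \<in> {0..<p}. p dvd poly f b} \<subseteq> insert c {b \<in> {0..<p}. p dvd poly g b}"
    proof
      fix b assume b: "b \<in> {b \<in> {0..<p}. p dvd poly f b}"
      have "poly f b = (b - c) * poly g b + poly f c"
        using arg_cong[OF synthetic_div_correct'[of c f], of "\<lambda>h. poly h b"] by (simp add: g_def algebra_simps)
      then have "p dvd (b - c) * poly g b" using b c by (metis (mono_tags, lifting) dvd_add_left_iff mem_Collect_eq)
      then have "p dvd b - c \<or> p dvd poly g b" using assms(1) prime_dvd_mult_iff by blast
      moreover have "b = c" if "p dvd b - c"
      proof (rule ccontr)
        assume "b \<noteq> c"
        then have "\<bar>p\<bar> \<le> \<bar>b - c\<bar>" using that dvd_imp_le_int[of "b - c" p] by simp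
        then show False using b c by auto
      qed
      ultimately show "b \<in> insert c {b \<in> {0..<p}. p dvd poly g b}" using b by auto
    qed
    then have "card {b \<in> {0..<p}. p dvd poly f b} \<le> card (insert c {b \<in> {0..<p}. p dvd poly g b})"
      by (intro card_mono finite.insertI finite_Collect_conjI disjI1) auto
    also have "\<dots> \<le> Suc n"
      using IH card_insert_le_m1[of "Suc n" "{b \<in> {0..<p}. p dvd poly g b}" c] by simp
    finally show ?thesis using Suc by simp
  qed
qed

text \<open>Modulo q, \<open>V b q\<close> is b^q by \<open>V_prime_cong\<close>, and b^q is b by
  Fermat.\<close>

lemma V_prime_cong_self:
  assumes "prime q" "odd q" "0 \<le> b" "b < int q"
  shows "int q dvd V b q - b"
proof -
  have pq: "prime (int q)" using assms(1) by simp
  have "\<not> int q dvd 2"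
  proof
    assume "int q dvd 2"
    then have "q \<le> 2" by (auto dest: zdvd_imp_le)
    then show False using assms(1,2) prime_ge_2_nat[OF assms(1)] by (cases "q = 2") auto
  qed
  moreover have "int q dvd 2 * (V b q - b ^ q)" using V_prime_cong[OF assms(1), of b] by simp
  ultimately have 1: "int q dvd V b q - b ^ q" using pq prime_dvd_mult_iff by blast
  have "int q dvd b ^ q - b"
  proof (cases "b = 0")
    case True then show ?thesis using assms(1) prime_gt_0_nat by (simp add: power_0_left)
  next
    case False
    define c where "c = nat b"
    have b: "b = int c" using assms by (simp add: c_def)
    have "\<not> q dvd c" using False assms b by (auto dest: dvd_imp_le)
    then have "[c ^ (q - 1) = 1] (mod q)" using fermat_theorem assms(1) by blast
    then have "[b ^ (q - 1) = 1] (mod int q)" unfolding b by (metis cong_int_iff of_nat_1 of_nat_power)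
    then have "[b ^ (q - 1) * b = 1 * b] (mod int q)" by (rule cong_mult) simp
    moreover have "b ^ (q - 1) * b = b ^ q"
      using prime_gt_0_nat[OF assms(1)] by (metis power_minus_mult)
    ultimately show ?thesis by (simp add: cong_iff_dvd_diff)
  qed
  then show ?thesis using 1 dvd_add[of "int q" "V b q - b ^ q" "b ^ q - b"] by simp
qed

text \<open>Modulo \<open>q\<close>, at least one of \<open>V b (q + 1)\<close>, \<open>V b (q - 1)\<close> is \<open>2\<close> for every \<open>b\<close>
  (as \<open>b = z + 1/z\<close> with \<open>z\<close> in the field of order \<open>q\<^sup>2\<close>), and root counting shows that each
  of them is \<open>2\<close> about half of the time.\<close>

lemma exists_root_W_mod_prime:
  assumes "prime q" "q \<ge> 7" "d \<ge> 2" "2 * d + 1 dvd q + 1 \<or> 2 * d + 1 dvd q - 1"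
  shows "\<exists>b::int. int q dvd W b d"
proof -
  have pq: "prime (int q)" and oq: "odd q"
    using assms(1,2) prime_odd_nat by auto
  define N where "N = {0..<int q}"
  \<comment> \<open>\<open>u\<close> is the one of q + 1, q - 1 that \<open>2 * d + 1\<close>
    divides, \<open>w\<close> the other.\<close>
  obtain u w where uw: "{u, w} = {q + 1, q - 1}" and "2 * d + 1 dvd u"
    using assms(4) by blast
  then obtain s where s: "u = (2 * d + 1) * s" by (auto elim: dvdE)
  have "even w" "w \<ge> 2" "w \<le> q + 1" "u \<le> q + 1" "u > 0" using uw oq assms(2) by (auto simp: doubleton_eq_iff)
  then obtain m where m: "w = 2 * m + 2" by (metis evenE le_add_diff_inverse2 dvd_diff_nat dvd_refl)
  have "5 * s \<le> (2 * d + 1) * s" using assms(3) by (intro mult_right_mono) auto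
  then have s5: "5 * s \<le> q + 1" using \<open>u \<le> q + 1\<close> unfolding s by (rule order.trans)
  have s0: "s > 0" using s \<open>u > 0\<close> by (cases s) auto
  define R1 where "R1 = {b \<in> N. int q dvd V b w - 2}"
  define R2 where "R2 = {b \<in> N. int q dvd V b s - 2}"
  have "R2 = {b \<in> N. int q dvd poly (V X s - 2) b}"
    by (simp add: R2_def poly_lucas)
  moreover have "degree (V X s - 2) = s" "lead_coeff (V X s - 2) = 1"
  proof -
    have V: "degree (V X s) = s" "lead_coeff (V X s) = 1"
      using lucas_X_monic[of 2 X s] s0 by (simp_all add: degree_numeral)
    have "V X s - 2 = [:-2:] + V X s" by (simp add: numeral_poly)
    moreover have "degree ([:-2:] + V X s) = s" using V s0 by (subst degree_add_eq_right) auto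
    moreover have "coeff ([:-2:] + V X s) s = 1" using V s0 by (cases s) auto
    ultimately show "degree (V X s - 2) = s" "lead_coeff (V X s - 2) = 1" by simp_all
  qed
  ultimately have R2: "card R2 \<le> s" using card_roots_mod_prime[OF pq, of "V X s - 2"] by (simp add: N_def)
  have U: "degree (U X m) = m" "lead_coeff (U X m) = 1"
    using lucas_X_monic[of 1 X m] by (cases "m = 0"; simp)+
  \<comment> \<open>By \<open>V_even_eq\<close> the roots of \<open>V b w - 2\<close> modulo q are
    2, -2 and those of \<open>U b m\<close>: at most m + 2 of them, about w/2.\<close>
  have "R1 \<subseteq> {b \<in> N. int q dvd poly [:-4, 0, 1:] b} \<union> {b \<in> N. int q dvd poly (U X m) b}"
  proof
    fix b assume "b \<in> R1"
    then have "int q dvd (b\<^sup>2 - 4) * (U b m)\<^sup>2" "b \<in> N"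
      using V_even_eq[of b m] m by (auto simp: R1_def)
    then have "int q dvd b\<^sup>2 - 4 \<or> int q dvd U b m"
      using pq by (meson prime_dvd_mult_iff prime_dvd_power)
    then show "b \<in> {b \<in> N. int q dvd poly [:-4, 0, 1:] b} \<union> {b \<in> N. int q dvd poly (U X m) b}"
      using \<open>b \<in> N\<close> by (auto simp: poly_lucas power2_eq_square)
  qed
  then have "card R1 \<le> card ({b \<in> N. int q dvd poly [:-4, 0, 1:] b} \<union> {b \<in> N. int q dvd poly (U X m) b})"
    by (intro card_mono finite_UnI finite_Collect_conjI disjI1) (auto simp: N_def)
  also have "\<dots> \<le> card {b \<in> N. int q dvd poly [:-4, 0, 1:] b} + card {b \<in> N. int q dvd poly (U X m) b}"
    by (rule card_Un_le)
  also have "\<dots> \<le> 2 + m"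
    using card_roots_mod_prime[OF pq, of "[:-4, 0, 1:]"] card_roots_mod_prime[OF pq, of "U X m"] U
    unfolding N_def by simp
  finally have R1: "card R1 \<le> 2 + m" .
  have "card (R1 \<union> R2) \<le> 2 + m + s" using card_Un_le[of R1 R2] R1 R2 by linarith
  \<comment> \<open>Here m + 2 = w/2 + 1 is at most (q + 3)/2 and s is at most (q + 1)/5; the sum is
    below q as q >= 7.\<close>
  also have "\<dots> < q" using m s5 \<open>w \<le> q + 1\<close> assms(2) by linarith
  also have "q = card N" by (simp add: N_def)
  finally have "card (R1 \<union> R2) < card N" .
  moreover have "finite (R1 \<union> R2)"
    by (rule finite_subset[of _ N]) (auto simp: R1_def R2_def N_def)
  ultimately have "\<not> N \<subseteq> R1 \<union> R2" using card_mono[of "R1 \<union> R2" N] by linarith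
  then obtain b where b: "b \<in> N" "\<not> int q dvd V b w - 2" "\<not> int q dvd V b s - 2"
    by (auto simp: R1_def R2_def)
  have "int q dvd V b q - b" using V_prime_cong_self[OF assms(1) oq] b(1) by (simp add: N_def)
  then have "int q dvd (V b q - b)\<^sup>2" by (simp add: power2_eq_square)
  moreover have "(V b (q + 1) - 2) * (V b (q - 1) - 2) = (V b q - b)\<^sup>2"
    using V_neighbours[of b "q - 1"] assms(2) by (simp del: lucas.simps)
  ultimately have "int q dvd (V b (q + 1) - 2) * (V b (q - 1) - 2)" by simp
  then have "int q dvd (V b u - 2) * (V b w - 2)" using uw by (auto simp: doubleton_eq_iff mult.commute)
  then have "int q dvd V b u - 2" using b pq by (simp add: prime_dvd_mult_iff)
  \<comment> \<open>As \<open>V b s\<close> is not 2 modulo q, the other factor vanishes, so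
    \<open>V b s\<close> is the desired root.\<close>
  moreover have "V b u - 2 = (V b s - 2) * (W (V b s) d)\<^sup>2"
    unfolding s using V_odd_eq[of "V b s" d] by (simp add: V_V)
  ultimately have "int q dvd W (V b s) d"
    using b pq by (metis prime_dvd_mult_iff prime_dvd_power)
  then show ?thesis by blast
qed

section \<open>Integers of the real cyclotomic field\<close>

text \<open>Integers of the field are represented by integer polynomials, not reduced modulo the
  minimal polynomial; the values of \<open>ev f\<close> at the conjugates of 2 cos (2 pi/r) are the
  conjugates of the integer.\<close>

definition ev :: "int poly \<Rightarrow> real \<Rightarrow> real" where
  "ev f x = poly (map_poly of_int f) x"

lemma ev_pCons [simp]: "ev (pCons a f) x = of_int a + x * ev f x"
  by (simp add: ev_def map_poly_pCons)

lemma ev_0 [simp]: "ev 0 x = 0" by (simp add: ev_def)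

lemma ev_1 [simp]: "ev 1 x = 1" by (simp add: one_pCons)

lemma ev_numeral [simp]: "ev (numeral n) x = numeral n" by (simp add: numeral_poly)

lemma ev_of_nat [simp]: "ev (of_nat n) x = of_nat n" by (simp add: of_nat_poly)

lemma ev_add [simp]: "ev (f + g) x = ev f x + ev g x"
  by (induction f g rule: poly_induct2) (auto simp: algebra_simps)

lemma ev_smult [simp]: "ev (smult c f) x = of_int c * ev f x"
  by (induction f) (auto simp: algebra_simps)

lemma ev_minus [simp]: "ev (- f) x = - ev f x"
  using ev_smult[of "-1" f x] by simp

lemma ev_diff [simp]: "ev (f - g) x = ev f x - ev g x"
  using ev_add[of f "- g" x] by simp

lemma ev_mult [simp]: "ev (f * g) x = ev f x * ev g x"
  by (induction f) (auto simp: algebra_simps)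

lemma ev_power [simp]: "ev (f ^ n) x = ev f x ^ n"
  by (induction n) auto

lemma ev_prod [simp]: "ev (\<Prod>i\<in>I. f i) x = (\<Prod>i\<in>I. ev (f i) x)"
  by (induction I rule: infinite_finite_induct) auto

lemma ev_sum [simp]: "ev (\<Sum>i\<in>I. f i) x = (\<Sum>i\<in>I. ev (f i) x)"
  by (induction I rule: infinite_finite_induct) auto

lemma ev_pcompose [simp]: "ev (f \<circ>\<^sub>p g) x = ev f (ev g x)"
  by (induction f) (auto simp: pcompose_pCons)

lemma ev_lucas: "ev (lucas a b c n) x = lucas (ev a x) (ev b x) (ev c x) n"
  by (induction n rule: induct_nat_012) auto

text \<open>Pseudo-division scales the dividend by a power of the leading coefficient, which is 1
  here.\<close>

lemma monic_division:
  fixes f g :: "int poly"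
  assumes "lead_coeff g = 1" "degree g > 0"
  obtains h s where "f = g * h + s" "degree s < degree g"
proof -
  obtain h s where hs: "pseudo_divmod f g = (h, s)" by force
  have "g \<noteq> 0" using assms by auto
  from pseudo_divmod[OF this hs] assms show ?thesis by (intro that[of h s]) auto
qed

section \<open>Conjugates and Galois action\<close>

locale real_cyclotomic =
  fixes r d :: nat
  assumes prime_r: "prime r" and r_eq: "r = 2 * d + 1" and d_pos: "d > 0"
begin

definition \<beta> :: "nat \<Rightarrow> real" where
  "\<beta> n = 2 * cos (2 * pi * real n / real r)"

definition B :: "real set" where
  "B = \<beta> ` {1..d}"

text \<open>At z + 1/z this is the r-th cyclotomic polynomial in z divided by z^d.\<close>

abbreviation \<Psi> :: "int poly" where
  "\<Psi> \<equiv> W X d"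

lemma r_pos: "real r > 0" using r_eq by simp

lemma V_beta: "V (\<beta> j) a = \<beta> (a * j)"
  using V_cos[of "2 * pi * real j / real r" a] by (simp add: \<beta>_def algebra_simps)

lemma beta_mod: "\<beta> (n mod r) = \<beta> n"
proof -
  have "real n = real (n mod r) + real r * real (n div r)"
    by (metis mod_mult_div_eq of_nat_add of_nat_mult)
  then have "2 * pi * real n / real r = 2 * pi * real (n mod r) / real r + 2 * pi * real_of_int (int (n div r))"
    using r_pos by (simp add: field_simps)
  then have "cos (2 * pi * real n / real r) = cos (2 * pi * real (n mod r) / real r)"
    using sin_cos_eq_iff by blast
  then show ?thesis by (simp add: \<beta>_def)
qed

lemma beta_reflect: "n \<le> r \<Longrightarrow> \<beta> (r - n) = \<beta> n"
proof -
  assume "n \<le> r"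
  then have "2 * pi * real (r - n) / real r = 2 * pi - 2 * pi * real n / real r"
    using r_pos by (simp add: field_simps of_nat_diff)
  then show ?thesis by (simp add: \<beta>_def cos_diff)
qed

lemma beta_in_B:
  assumes "\<not> r dvd n"
  shows "\<beta> n \<in> B"
proof -
  define m where "m = n mod r"
  have m: "m > 0" "m < r" using assms r_eq by (auto simp: m_def dvd_eq_mod_eq_0)
  show ?thesis
  proof (cases "m \<le> d")
    case True
    then have "m \<in> {1..d}" using m by simp
    moreover have "\<beta> m = \<beta> n" by (simp add: m_def beta_mod)
    ultimately show ?thesis unfolding B_def by (metis imageI)
  next
    case False
    then have "r - m \<in> {1..d}" using m r_eq by auto
    moreover have "\<beta> (r - m) = \<beta> n" using beta_reflect[of m] m by (simp add: m_def beta_mod)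
    ultimately show ?thesis unfolding B_def by (metis imageI)
  qed
qed

lemma angle_bounds:
  assumes "j \<in> {1..d}"
  shows "0 \<le> 2 * pi * real j / real r" "2 * pi * real j / real r \<le> pi"
proof -
  have "2 * real j \<le> real r" using assms r_eq by auto
  then have "pi * (2 * real j) \<le> pi * real r" by (intro mult_left_mono) auto
  then show "2 * pi * real j / real r \<le> pi" using r_pos by (simp add: divide_le_eq mult_ac)
qed simp

lemma inj_beta: "inj_on \<beta> {1..d}"
proof (rule inj_onI)
  fix i j assume ij: "i \<in> {1..d}" "j \<in> {1..d}" "\<beta> i = \<beta> j"
  then have "2 * pi * real i / real r = 2 * pi * real j / real r"
    using ij(3) cos_inj_pi[OF angle_bounds[OF ij(1)] angle_bounds[OF ij(2)]]
    unfolding \<beta>_def by linarith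
  then show "i = j" using r_pos by simp
qed

lemma finite_B: "finite B" by (simp add: B_def)

lemma card_B: "card B = d" using card_image[OF inj_beta] by (simp add: B_def)

lemma not_dvd: "j \<in> {1..d} \<Longrightarrow> \<not> r dvd j"
  using r_eq by (auto dest: dvd_imp_le)

lemma B_cases:
  assumes "x \<in> B"
  obtains a where "x = \<beta> a" "a \<in> {1..d}"
  using assms by (auto simp: B_def)

text \<open>This is the Galois action \<open>\<beta> j\<close> -> \<open>\<beta> (a * j)\<close>; an
  inverse of \<open>a\<close> modulo r gives the inverse map.\<close>

lemma V_permutes_B:
  assumes "\<not> r dvd a"
  shows "bij_betw (\<lambda>x. V x a) B B"
proof -
  have "coprime a r" using assms prime_r by (metis coprime_commute prime_imp_coprime_nat)
  then obtain c where c: "[a * c = 1] (mod r)" using cong_solve_coprime_nat by force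
  have "V (V x a) c = x" if "x \<in> B" for x
  proof -
    from that obtain j where j: "x = \<beta> j" by (auto simp: B_def)
    have "[c * a * j = j] (mod r)" using cong_mult[OF c cong_refl[of j r]] by (simp add: mult_ac)
    then have "\<beta> (c * a * j) = \<beta> j" 
      using beta_mod[of "c * a * j"] beta_mod[of j] by (simp add: cong_def)
    then show ?thesis by (simp add: j V_beta mult_ac)
  qed
  then have inj: "inj_on (\<lambda>x. V x a) B" by (rule inj_on_inverseI)
  moreover have "(\<lambda>x. V x a) ` B \<subseteq> B"
  proof (intro image_subsetI)
    fix x assume "x \<in> B"
    then obtain j where j: "x = \<beta> j" "j \<in> {1..d}" by (rule B_cases)
    then have "\<not> r dvd a * j" using assms not_dvd prime_r by (simp add: prime_dvd_mult_iff)
    then show "V x a \<in> B" using j V_beta beta_in_B by simp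
  qed
  ultimately show ?thesis using finite_B by (simp add: bij_betw_def endo_inj_surj)
qed

lemma B_bound: "x \<in> B \<Longrightarrow> \<bar>x\<bar> \<le> 2"
  by (auto simp: B_def \<beta>_def abs_mult)

lemma B_neq_2: "x \<in> B \<Longrightarrow> x \<noteq> 2"
proof
  assume "x \<in> B" "x = 2"
  then obtain j where j: "\<beta> j = 2" "j \<in> {1..d}" by (auto simp: B_def)
  then have "cos (2 * pi * real j / real r) = cos 0" by (simp add: \<beta>_def)
  then have "2 * pi * real j / real r = 0"
    by (rule cos_inj_pi[OF angle_bounds[OF j(2)] order_refl pi_ge_zero])
  then show False using j r_pos by simp
qed

lemma W_B: "x \<in> B \<Longrightarrow> W x d = 0"
proof -
  assume x: "x \<in> B"
  then obtain j where j: "x = \<beta> j" by (auto simp: B_def)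
  have "V x r = \<beta> (r * j)" by (simp add: j V_beta)
  also have "\<dots> = \<beta> 0" by (metis beta_mod mod_mult_self1_is_0 mod_0)
  also have "\<dots> = 2" by (simp add: \<beta>_def)
  finally have "(x - 2) * (W x d)\<^sup>2 = 0" using V_odd_eq[of x d] r_eq by simp
  then show ?thesis using B_neq_2[OF x] by simp
qed

lemma ev_Psi: "x \<in> B \<Longrightarrow> ev \<Psi> x = 0"
  using W_B[of x] by (simp add: ev_lucas)

lemma degree_Psi: "degree \<Psi> = d" and monic_Psi: "lead_coeff \<Psi> = 1"
  using lucas_X_monic[of 1 "X + 1" d] d_pos by (simp_all add: one_pCons)

text \<open>Replaces the fundamental theorem on symmetric functions: the remainder modulo \<open>\<Psi>\<close> has
  degree below \<open>d = card B\<close>, so it is constant if it takes a single value on \<open>B\<close>.\<close>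

lemma constant_on_B_imp:
  assumes "\<And>x. x \<in> B \<Longrightarrow> ev G x = v"
  obtains N h where "v = of_int N" "G = [:N:] + \<Psi> * h"
proof -
  obtain h s where hs: "G = \<Psi> * h + s" "degree s < d"
    using monic_division[of \<Psi> G] degree_Psi monic_Psi d_pos by metis
  have "poly (map_poly of_int s) x = poly [:v:] x" if "x \<in> B" for x
    using assms[OF that] ev_Psi[OF that] hs(1) by (simp add: ev_def[symmetric])
  then have eq: "map_poly of_int s = [:v:]"
    by (rule poly_eqI_degree[of B]) (use hs(2) d_pos in \<open>simp_all add: card_B degree_map_poly\<close>)
  then have "v = of_int (coeff s 0)" by (metis coeff_map_poly coeff_pCons_0 of_int_0)
  moreover have "s = [:coeff s 0:]"
  proof -
    have "degree s = 0" using arg_cong[OF eq, of degree] by (simp add: degree_map_poly)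
    then show ?thesis by (metis degree_eq_zeroE coeff_pCons_0)
  qed
  ultimately show ?thesis using hs(1) that[of "coeff s 0" h] by (metis add.commute)
qed

section \<open>Norm and trace\<close>

lemma
  assumes "x \<in> B"
  shows prod_V_eq_prod_B: "(\<Prod>j=1..d. F (V x j)) = (\<Prod>y\<in>B. F y :: real)"
    and sum_V_eq_sum_B: "(\<Sum>j=1..d. F (V x j)) = (\<Sum>y\<in>B. F y :: real)"
proof -
  obtain a where a: "x = \<beta> a" "a \<in> {1..d}" using assms by (rule B_cases)
  have bij: "bij_betw (\<lambda>j. V (\<beta> j) a) {1..d} B"
    using bij_betw_trans[of \<beta> "{1..d}" B "\<lambda>x. V x a" B] V_permutes_B[OF not_dvd[OF a(2)]] inj_beta
    by (simp add: bij_betw_def B_def comp_def)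
  \<comment> \<open>Swapping the roles lets \<open>\<beta> j\<close> run through B, while the fixed
    index \<open>a\<close> only permutes B.\<close>
  have "V x j = V (\<beta> j) a" for j by (simp add: a V_beta mult.commute)
  then show "(\<Prod>j=1..d. F (V x j)) = (\<Prod>y\<in>B. F y)" "(\<Sum>j=1..d. F (V x j)) = (\<Sum>y\<in>B. F y)"
    using prod.reindex_bij_betw[OF bij, of F] sum.reindex_bij_betw[OF bij, of F] by simp_all
qed

text \<open>The norm as a polynomial identity modulo \<open>\<Psi>\<close>, so that it can be
  evaluated both at a root of \<open>\<Psi>\<close> modulo q and at 2, where \<open>\<Psi>\<close>
  is r.\<close>

lemma norm_int:
  obtains N h where "(\<Prod>x\<in>B. ev f x) = of_int N"
    "\<And>t. (\<Prod>j=1..d. poly f (V t j)) = N + W t d * poly h t"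
proof -
  define G where "G = (\<Prod>j=1..d. f \<circ>\<^sub>p V X j)"
  have "ev G x = (\<Prod>x\<in>B. ev f x)" if "x \<in> B" for x
    using prod_V_eq_prod_B[OF that, of "ev f"] by (simp add: G_def ev_lucas)
  then obtain N h where N: "(\<Prod>x\<in>B. ev f x) = of_int N" "G = [:N:] + \<Psi> * h"
    by (rule constant_on_B_imp)
  have "(\<Prod>j=1..d. poly f (V t j)) = N + W t d * poly h t" for t
    using arg_cong[OF N(2), of "\<lambda>p. poly p t"]
    by (simp add: G_def poly_prod poly_pcompose poly_lucas add.commute)
  with N(1) show ?thesis by (rule that)
qed

lemma trace_int: "\<exists>N. (\<Sum>x\<in>B. ev f x) = of_int N"
proof -
  define G where "G = (\<Sum>j=1..d. f \<circ>\<^sub>p V X j)"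
  have "ev G x = (\<Sum>x\<in>B. ev f x)" if "x \<in> B" for x
    using sum_V_eq_sum_B[OF that, of "ev f"] by (simp add: G_def ev_lucas)
  then show ?thesis by (metis constant_on_B_imp)
qed

section \<open>Ramification at r and irreducibility\<close>

lemma prime_elem_r: "prime_elem (of_nat r :: int poly)"
  using prime_r by (simp add: of_nat_poly prime_elem_const_poly_iff prime_imp_prime_elem)

lemma r_not_dvd: "\<bar>coeff f n\<bar> \<in> {1..2} \<Longrightarrow> \<not> (of_nat r :: int poly) dvd f"
proof
  assume a: "\<bar>coeff f n\<bar> \<in> {1..2}" "(of_nat r :: int poly) dvd f"
  then have "int r dvd coeff f n" by (simp add: of_nat_poly const_poly_dvd_iff)
  then have "\<bar>int r\<bar> \<le> \<bar>coeff f n\<bar>" using a(1) by (intro dvd_imp_le_int) auto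
  then show False using a(1) r_eq d_pos by auto
qed

lemma V_r_cong: "(of_nat r :: int poly) dvd V f r - f ^ r"
proof -
  have "\<not> (of_nat r :: int poly) dvd 2"
    by (rule r_not_dvd[of _ 0]) (simp add: numeral_poly)
  then show ?thesis using V_prime_cong[OF prime_r, of f] prime_elem_r prime_elem_dvd_mult_iff by blast
qed

text \<open>Modulo r, with Y = X - 2, \<open>V_odd_eq\<close> and Frobenius give Y
  \<open>\<Psi>\<close>^2 = Y^r. So r divides Y (\<open>\<Psi>\<close> - Y^d)(\<open>\<Psi>\<close>
  + Y^d); the last factor has leading coefficient 2, which rules it out.\<close>

lemma Psi_cong: "of_nat r dvd \<Psi> - [:-2, 1:] ^ d"
proof -
  define Y :: "int poly" where "Y = [:-2, 1:]"
  have XY: "X = Y + 2" by (simp add: Y_def numeral_poly)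
  have "of_nat r dvd X ^ r - (Y ^ r + 2 ^ r)"
    unfolding XY by (rule freshmans_dream_cong[OF prime_r])
  moreover have "of_nat r dvd V X r - X ^ r" by (rule V_r_cong)
  moreover have "of_nat r dvd 2 - (2::int poly) ^ r" using V_r_cong[of 2] by simp
  ultimately have "of_nat r dvd (X ^ r - (Y ^ r + 2 ^ r)) + (V X r - X ^ r) - (2 - (2::int poly) ^ r)"
    by (rule dvd_diff[OF dvd_add])
  also have "\<dots> = (V X (2 * d + 1) - 2) - Y ^ r" by (simp add: r_eq)
  also have "V X (2 * d + 1) - 2 = Y * \<Psi>\<^sup>2"
    unfolding V_odd_eq by (simp add: XY)
  also have "Y * \<Psi>\<^sup>2 - Y ^ r = Y * ((\<Psi> - Y ^ d) * (\<Psi> + Y ^ d))"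
    by (simp add: r_eq algebra_simps power2_eq_square power_mult mult_2 power_add)
  finally have "of_nat r dvd Y * ((\<Psi> - Y ^ d) * (\<Psi> + Y ^ d))" .
  moreover have "\<not> of_nat r dvd Y" by (rule r_not_dvd[of _ 1]) (simp add: Y_def)
  moreover have "\<not> of_nat r dvd \<Psi> + Y ^ d"
  proof (rule r_not_dvd[of _ d])
    have "degree (Y ^ d) = d" by (simp add: Y_def degree_power_eq)
    moreover have "lead_coeff (Y ^ d) = 1" by (simp add: Y_def lead_coeff_power)
    ultimately show "\<bar>coeff (\<Psi> + Y ^ d) d\<bar> \<in> {1..2}" using monic_Psi degree_Psi by simp
  qed
  ultimately show ?thesis 
    using prime_elem_dvd_mult_iff[OF prime_elem_r] unfolding Y_def by blast
qed

text \<open>\<open>\<Psi>\<close> is Eisenstein at \<open>r\<close> in the variable \<open>X - 2\<close>. Here its irreducibility takes the form that an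
  integer polynomial with one root in \<open>B\<close> is divisible by \<open>r\<close> modulo \<open>\<Psi>\<close>, with a quotient that has the
  same root; descent on the integer \<open>\<Sum>y\<in>B. (ev f y)\<^sup>2\<close> then shows that it vanishes on \<open>B\<close>.\<close>

lemma root_imp_mult_X_minus_2:
  assumes "x \<in> B" "ev f x = 0"
  shows "\<exists>g h. f = [:-2, 1:] * g + \<Psi> * h \<and> ev g x = 0"
proof -
  obtain N h where N: "(\<Prod>x\<in>B. ev f x) = of_int N"
    "\<And>t. (\<Prod>j=1..d. poly f (V t j)) = N + W t d * poly h t"
    using norm_int[of f] by blast
  have "(\<Prod>x\<in>B. ev f x) = 0" using assms finite_B by (meson prod_zero)
  then have "N = 0" using N(1) by simp
  \<comment> \<open>At t = 2 every \<open>V t j\<close> is 2 and \<open>W t d\<close> is r.\<close>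
  then have "poly f 2 ^ d = int r * poly h 2" using N(2)[of 2] W_two[of d, where 'a = int] by (simp add: r_eq)
  then have "int r dvd poly f 2" using prime_r by (metis dvd_triv_left prime_dvd_power prime_nat_int_transfer)
  then obtain m where m: "poly f 2 = int r * m" by (rule dvdE)
  \<comment> \<open>Since \<open>\<Psi>\<close> is r at 2, subtracting m times it creates a root at
    2.\<close>
  have "poly (f - [:m:] * \<Psi>) 2 = 0" 
    using W_two[of d, where 'a = int] by (simp add: m poly_lucas r_eq)
  then obtain g where g: "f - [:m:] * \<Psi> = [:-2, 1:] * g" unfolding poly_eq_0_iff_dvd by (rule dvdE)
  have "ev (f - [:m:] * \<Psi>) x = 0" using assms ev_Psi by simp
  then have "(x - 2) * ev g x = 0" unfolding g by auto
  then have "ev g x = 0" using B_neq_2[OF assms(1)] by simp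
  moreover have "f = [:-2, 1:] * g + \<Psi> * [:m:]" using g by (simp add: algebra_simps)
  ultimately show ?thesis by blast
qed

lemma root_imp_mult_r:
  assumes "x \<in> B" "ev f x = 0"
  shows "\<exists>g h. f = of_nat r * g + \<Psi> * h \<and> ev g x = 0"
proof -
  have "\<exists>g h. f = [:-2, 1:] ^ k * g + \<Psi> * h \<and> ev g x = 0" for k
  proof (induction k)
    case 0
    show ?case using assms by (intro exI[of _ f] exI[of _ 0]) simp
  next
    case (Suc k)
    then obtain g h where gh: "f = [:-2, 1:] ^ k * g + \<Psi> * h" "ev g x = 0" by blast
    obtain g' h' where "g = [:-2, 1:] * g' + \<Psi> * h'" "ev g' x = 0"
      using root_imp_mult_X_minus_2[OF assms(1) gh(2)] by blast
    moreover from this have "f = [:-2, 1:] ^ Suc k * g' + \<Psi> * ([:-2, 1:] ^ k * h' + h)"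
      unfolding gh(1) power_Suc by (simp only: ring_distribs mult_ac add_ac)
    ultimately show ?case by blast
  qed
  then obtain g h where gh: "f = [:-2, 1:] ^ d * g + \<Psi> * h" "ev g x = 0" by blast
  \<comment> \<open>Modulo \<open>\<Psi>\<close>, the power (X - 2)^d is -r w, which turns d factors
    X - 2 into a factor r.\<close>
  obtain w where w: "\<Psi> - [:-2, 1:] ^ d = of_nat r * w" using Psi_cong by (rule dvdE)
  then have "f = of_nat r * (- (w * g)) + \<Psi> * (g + h)"
    unfolding gh(1) by (simp add: algebra_simps eq_diff_eq diff_eq_eq)
  then show ?thesis using gh(2) by (intro exI[of _ "- (w * g)"] exI[of _ "g + h"]) simp
qed

lemma root_imp_root_all:
  assumes "x \<in> B" "ev f x = 0" "y \<in> B"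
  shows "ev f y = 0"
proof -
  have "n = 0" if "ev f x = 0" "(\<Sum>y\<in>B. (ev f y)\<^sup>2) = real n" for n f
    using that
  proof (induction n arbitrary: f rule: less_induct)
    case (less n)
    obtain g h where gh: "f = of_nat r * g + \<Psi> * h" "ev g x = 0"
      using root_imp_mult_r[OF assms(1) less.prems(1)] by blast
    obtain m where m: "(\<Sum>y\<in>B. ev (g\<^sup>2) y) = of_int m" using trace_int by blast
    have "m \<ge> 0"
    proof -
      have "0 \<le> (\<Sum>y\<in>B. ev (g\<^sup>2) y)" by (intro sum_nonneg) simp
      then show ?thesis unfolding m by simp
    qed
    then have sg: "(\<Sum>y\<in>B. (ev g y)\<^sup>2) = real (nat m)" using m by simp
    \<comment> \<open>On B, \<open>\<Psi>\<close> vanishes and f is r g, so the sum of squares drops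
      by the factor r^2.\<close>
    have "real n = (\<Sum>y\<in>B. (real r)\<^sup>2 * (ev g y)\<^sup>2)"
      unfolding less.prems(2)[symmetric] gh(1)
      by (intro sum.cong) (simp_all add: ev_Psi power_mult_distrib)
    also have "\<dots> = (real r)\<^sup>2 * real (nat m)" by (simp add: sg flip: sum_distrib_left)
    finally have n: "n = r\<^sup>2 * nat m" by (metis of_nat_eq_iff of_nat_mult of_nat_power)
    show "n = 0"
    proof (rule ccontr)
      assume "n \<noteq> 0"
      have "r\<^sup>2 > 1" using prime_gt_1_nat[OF prime_r] by (rule one_less_power) simp
      then have "nat m < n" using n \<open>n \<noteq> 0\<close> by (cases "nat m = 0") auto
      then have "nat m = 0" using less.IH gh(2) sg by blast
      then show False using n \<open>n \<noteq> 0\<close> by simp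
    qed
  qed
  moreover obtain m where m: "(\<Sum>y\<in>B. ev (f\<^sup>2) y) = of_int m" using trace_int by blast
  moreover have "m \<ge> 0"
  proof -
    have "0 \<le> (\<Sum>y\<in>B. ev (f\<^sup>2) y)" by (intro sum_nonneg) simp
    then show ?thesis unfolding m by simp
  qed
  ultimately have "(\<Sum>y\<in>B. (ev f y)\<^sup>2) = 0"
    using assms(2) by (metis (mono_tags, lifting) ev_power nat_0_le of_nat_0 of_int_of_nat_eq sum.cong)
  then show ?thesis using assms(3) finite_B by (simp add: sum_nonneg_eq_0_iff)
qed

end

section \<open>The induced matching\<close>

lemma Poly_eq_imp_eq:
  assumes "Poly xs = Poly ys" "length xs = length ys"
  shows "xs = ys"
proof (rule nth_equalityI[OF assms(2)])
  fix i assume "i < length xs"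
  then show "xs ! i = ys ! i"
    using arg_cong[OF assms(1), of "\<lambda>p. coeff p i"] assms(2) by (simp add: nth_default_def)
qed

lemma ev_Poly_bound:
  assumes "set xs \<subseteq> {0..<int M}" "\<bar>y\<bar> \<le> 2"
  shows "\<bar>ev (Poly xs) y\<bar> \<le> real M * 2 ^ length xs"
proof -
  \<comment> \<open>The sharper geometric sum is what the induction reproduces.\<close>
  have "\<bar>ev (Poly xs) y\<bar> \<le> real M * (2 ^ length xs - 1)"
    using assms(1)
  proof (induction xs)
    case (Cons a xs)
    have "\<bar>y * ev (Poly xs) y\<bar> \<le> 2 * (real M * (2 ^ length xs - 1))"
      unfolding abs_mult using assms(2) Cons by (intro mult_mono) auto
    moreover have "\<bar>real_of_int a\<bar> \<le> real M" using Cons.prems by auto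
    moreover have "\<bar>of_int a + y * ev (Poly xs) y\<bar> \<le> \<bar>of_int a\<bar> + \<bar>y * ev (Poly xs) y\<bar>"
      by (rule abs_triangle_ineq)
    ultimately show ?case by (simp add: algebra_simps)
  qed simp
  also have "\<dots> \<le> real M * 2 ^ length xs" by (intro mult_left_mono) auto
  finally show ?thesis .
qed

text \<open>The divisibility in \<open>sep\<close> is incidence of the point (u, u^2 + v) of
  \<open>s\<close> with the line -2 u x + y = v - u^2 of \<open>t\<close>; it always holds for s =
  t.\<close>

lemma card_le_IM2:
  fixes u v :: "'s \<Rightarrow> int"
  assumes "prime q" "finite S"
    and sep: "\<And>s t. \<lbrakk>s \<in> S; t \<in> S; int q dvd (u s - u t)\<^sup>2 + (v s - v t)\<rbrakk> \<Longrightarrow> s = t"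
  shows "card S \<le> IM2 (residue_ring (int q))"
proof -
  let ?F = "residue_ring (int q)"
  have q1: "int q > 1" using assms(1) prime_gt_1_nat by auto
  obtain e where e: "bij_betw e {0..<card S} S"
    using ex_bij_betw_nat_finite[OF assms(2)] by blast
  define p where "p i = (u (e i) mod int q, ((u (e i))\<^sup>2 + v (e i)) mod int q)" for i
  define l where "l j = {(x, y) \<in> plane ?F.
      ((- 2 * u (e j)) mod int q) \<otimes>\<^bsub>?F\<^esub> x \<oplus>\<^bsub>?F\<^esub> 1 \<otimes>\<^bsub>?F\<^esub> y = (v (e j) - (u (e j))\<^sup>2) mod int q}" for j
  have p: "p i \<in> plane ?F" for i
    using q1 by (auto simp: p_def plane_def residue_ring_def)
  have l: "affine_line ?F (l j)" for j
    unfolding affine_line_def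
  proof (intro bexI conjI)
    show "l j = {(x, y) \<in> plane ?F.
      ((- 2 * u (e j)) mod int q) \<otimes>\<^bsub>?F\<^esub> x \<oplus>\<^bsub>?F\<^esub> 1 \<otimes>\<^bsub>?F\<^esub> y = (v (e j) - (u (e j))\<^sup>2) mod int q}"
      by (rule l_def)
  qed (use q1 in \<open>auto simp: residue_ring_def\<close>)
  have inc: "p i \<in> l j \<longleftrightarrow> i = j" if ij: "i < card S" "j < card S" for i j
  proof -
    have mod_right: "(a - c * (x mod m)) mod m = (a - c * x) mod m" for a c x m :: int
      by (metis mod_diff_right_eq mod_mult_right_eq)
    have "p i \<in> l j \<longleftrightarrow> (- 2 * u (e j) * u (e i) + ((u (e i))\<^sup>2 + v (e i))) mod int q
        = (v (e j) - (u (e j))\<^sup>2) mod int q"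
      using p[of i] by (simp add: l_def p_def residue_ring_def mod_simps mod_right)
    also have "\<dots> \<longleftrightarrow> int q dvd (u (e i) - u (e j))\<^sup>2 + (v (e i) - v (e j))"
      unfolding mod_eq_dvd_iff by (simp add: power2_eq_square algebra_simps)
    also have "\<dots> \<longleftrightarrow> e i = e j"
      using sep[of "e i" "e j"] ij e by (auto dest: bij_betwE)
    also have "\<dots> \<longleftrightarrow> i = j"
      using e ij by (auto simp: bij_betw_def dest: inj_onD)
    finally show ?thesis .
  qed
  have "induced_matching ?F (card S) p l"
    using p l inc by (simp add: induced_matching_def)
  moreover have "finite (carrier ?F)" by (simp add: residue_ring_def)
  ultimately show ?thesis
    unfolding IM2_def by (intro Max_ge finite_induced_matching_sizes) blast+
qed

section \<open>Separation by norm and trace\<close>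

context real_cyclotomic
begin

text \<open>Modulo q the norm of f is a product containing f(b), so q divides it; being smaller than
  q it is 0. Then one conjugate vanishes, hence all do.\<close>

lemma zero_mod_prime_imp_zero:
  assumes "int q dvd W b d" "int q dvd poly f b"
    and bound: "\<And>x. x \<in> B \<Longrightarrow> \<bar>ev f x\<bar> \<le> M" and "M ^ d < real q" and "y \<in> B"
  shows "ev f y = 0"
proof -
  obtain N h where N: "(\<Prod>x\<in>B. ev f x) = of_int N"
    "\<And>t. (\<Prod>j=1..d. poly f (V t j)) = N + W t d * poly h t"
    using norm_int[of f] by blast
  have "poly f (V b 1) dvd (\<Prod>j=1..d. poly f (V b j))"
    using d_pos by (intro dvd_prodI) auto
  then have "int q dvd N + W b d * poly h b"
    using assms(2) N(2)[of b] by (simp, metis dvd_trans)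
  then have qN: "int q dvd N" using assms(1) by (simp add: dvd_add_left_iff)
  have "\<bar>\<Prod>x\<in>B. ev f x\<bar> \<le> (\<Prod>x\<in>B. M)"
    unfolding abs_prod using bound by (intro prod_mono) auto
  also have "\<dots> < real q" using assms(4) by (simp add: card_B)
  finally have "\<bar>N\<bar> < int q" unfolding N(1) by linarith
  then have "N = 0" using qN dvd_imp_le_int[of N "int q"] by auto
  then obtain x where "x \<in> B" "ev f x = 0" using N(1) finite_B by auto
  then show ?thesis using root_imp_root_all assms(5) by blast
qed

lemma ev_eq_on_B_imp_eq:
  assumes "degree f < d" "degree g < d" "\<And>y. y \<in> B \<Longrightarrow> ev f y = ev g y"
  shows "f = g"
proof -
  have "map_poly of_int f = (map_poly of_int g :: real poly)"
    using assms by (intro poly_eqI_degree[of B]) (auto simp: ev_def card_B degree_map_poly)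
  then show ?thesis by (metis coeff_map_poly of_int_0 of_int_eq_iff poly_eqI)
qed

text \<open>The sum is already an integer; the floor only changes its type.\<close>

definition trace :: "int poly \<Rightarrow> int" where
  "trace f = \<lfloor>\<Sum>y\<in>B. ev f y\<rfloor>"

lemma of_int_trace: "of_int (trace f) = (\<Sum>y\<in>B. ev f y)"
  unfolding trace_def using trace_int[of f] by auto

text \<open>Projection to trace 0, scaled by d to keep integer coefficients.\<close>

definition traceless :: "int poly \<Rightarrow> int poly" where
  "traceless f = smult (int d) f - [:trace f:]"

lemma sum_traceless: "(\<Sum>y\<in>B. ev (traceless f) y) = 0"
  by (simp add: traceless_def sum_subtractf of_int_trace card_B flip: sum_distrib_left)

text \<open>In the constant, \<open>4 * 4 ^ d\<close> bounds the square of a difference of two x and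
  \<open>4 * real d * 2 ^ d\<close> a difference of two k, each up to the factor A^2.\<close>

lemma induced_matching_count:
  assumes "prime q" "int q dvd W b d"
    and A: "((4 * 4 ^ d + 4 * real d * 2 ^ d) * (real A)\<^sup>2) ^ d < real q"
  shows "A ^ d * (A\<^sup>2) ^ (d - 1) \<le> IM2 (residue_ring (int q))"
proof -
  define S1 where "S1 = {xs. set xs \<subseteq> {0..<int A} \<and> length xs = d}"
  define S2 where "S2 = {ps. set ps \<subseteq> {0..<int (A\<^sup>2)} \<and> length ps = d - 1}"
  define fx :: "int list \<times> int list \<Rightarrow> int poly" where "fx s = Poly (fst s)" for s
  \<comment> \<open>The constant term is fixed at 0 because \<open>traceless\<close> kills
    constants; this leaves d - 1 free coefficients.\<close>
  define fp :: "int list \<times> int list \<Rightarrow> int poly" where "fp s = pCons 0 (Poly (snd s))" for s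
  define k where "k s = traceless (fp s)" for s
  have deg_Poly: "degree (Poly zs) < n" if "length zs \<le> n" "n > 0" for zs :: "int list" and n
    using that by (intro degree_lessI) (auto simp: nth_default_beyond)
  have deg_fx: "degree (fx s) < d" if "s \<in> S1 \<times> S2" for s
    using that d_pos by (auto simp: fx_def S1_def intro!: deg_Poly)
  have deg_fp: "degree (fp s) < d" if "s \<in> S1 \<times> S2" for s
  proof -
    have "fp s = Poly (0 # snd s)" by (simp add: fp_def)
    then show ?thesis using that d_pos by (auto simp: S2_def intro!: deg_Poly simp del: Poly.simps)
  qed
  have deg_k: "degree (k s) < d" if "s \<in> S1 \<times> S2" for s
  proof -
    have "degree (k s) \<le> max (degree (smult (int d) (fp s))) (degree [:trace (fp s):])"
      unfolding k_def traceless_def by (rule degree_diff_le_max)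
    also have "\<dots> < d" using deg_fp[OF that] d_pos by simp
    finally show ?thesis .
  qed
  have bound_fx: "\<bar>ev (fx s) y\<bar> \<le> real A * 2 ^ d" if "s \<in> S1 \<times> S2" "y \<in> B" for s y
    using that ev_Poly_bound[of "fst s" A y] B_bound[of y] by (auto simp: fx_def S1_def)
  have bound_fp: "\<bar>ev (fp s) y\<bar> \<le> (real A)\<^sup>2 * 2 ^ d" if "s \<in> S1 \<times> S2" "y \<in> B" for s y
  proof -
    have "2 * (2::real) ^ (d - 1) = 2 ^ d" using d_pos by (simp flip: power_Suc)
    then have "2 * (real (A\<^sup>2) * 2 ^ (d - 1)) = (real A)\<^sup>2 * 2 ^ d" by simp
    moreover have "\<bar>y * ev (Poly (snd s)) y\<bar> \<le> 2 * (real (A\<^sup>2) * 2 ^ (d - 1))"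
      unfolding abs_mult using that ev_Poly_bound[of "snd s" "A\<^sup>2" y] B_bound[of y]
      by (intro mult_mono) (auto simp: S2_def)
    moreover have "ev (fp s) y = y * ev (Poly (snd s)) y" by (simp add: fp_def)
    ultimately show ?thesis by (simp only:)
  qed
  have bound_k: "\<bar>ev (k s) y\<bar> \<le> 2 * real d * ((real A)\<^sup>2 * 2 ^ d)" if s: "s \<in> S1 \<times> S2" and y: "y \<in> B" for s y
  proof -
    have "\<bar>\<Sum>z\<in>B. ev (fp s) z\<bar> \<le> (\<Sum>z\<in>B. (real A)\<^sup>2 * 2 ^ d)"
      by (rule order.trans[OF sum_abs sum_mono]) (rule bound_fp[OF s])
    then have "\<bar>real_of_int (trace (fp s))\<bar> \<le> real d * ((real A)\<^sup>2 * 2 ^ d)"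
      by (simp add: of_int_trace card_B)
    moreover have "\<bar>real d * ev (fp s) y\<bar> \<le> real d * ((real A)\<^sup>2 * 2 ^ d)"
      unfolding abs_mult using bound_fp[OF s y] by (intro mult_mono) auto
    ultimately show ?thesis by (simp add: k_def traceless_def)
  qed
  have "s = t" if st: "s \<in> S1 \<times> S2" "t \<in> S1 \<times> S2"
    and dvd: "int q dvd (poly (fx s) b - poly (fx t) b)\<^sup>2 + (poly (k s) b - poly (k t) b)" for s t
  proof -
    define f where "f = (fx s - fx t)\<^sup>2 + (k s - k t)"
    have zero: "ev f y = 0" if "y \<in> B" for y
    proof (rule zero_mod_prime_imp_zero[OF assms(2) _ _ A that])
      show "int q dvd poly f b" using dvd by (simp add: f_def)
    next
      fix y assume y: "y \<in> B"
      have "\<bar>ev (fx s) y - ev (fx t) y\<bar> \<le> 2 * (real A * 2 ^ d)"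
        using bound_fx[OF st(1) y] bound_fx[OF st(2) y] by linarith
      then have "\<bar>ev (fx s) y - ev (fx t) y\<bar>\<^sup>2 \<le> (2 * (real A * 2 ^ d))\<^sup>2" by (intro power_mono) auto
      also have "\<dots> = 4 * 4 ^ d * (real A)\<^sup>2"
        by (simp add: power_mult_distrib power2_eq_square flip: power_mult_distrib[of "2::real" 2])
      finally have "(ev (fx s) y - ev (fx t) y)\<^sup>2 \<le> 4 * 4 ^ d * (real A)\<^sup>2" by simp
      moreover have "\<bar>ev (k s) y - ev (k t) y\<bar> \<le> 4 * real d * 2 ^ d * (real A)\<^sup>2"
        using bound_k[OF st(1) y] bound_k[OF st(2) y] by (simp add: mult_ac)
      moreover have "ev f y = (ev (fx s) y - ev (fx t) y)\<^sup>2 + (ev (k s) y - ev (k t) y)"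
        by (simp add: f_def)
      moreover have "(ev (fx s) y - ev (fx t) y)\<^sup>2 \<ge> 0" by simp
      ultimately show "\<bar>ev f y\<bar> \<le> (4 * 4 ^ d + 4 * real d * 2 ^ d) * (real A)\<^sup>2"
        unfolding distrib_right by linarith
    qed
    \<comment> \<open>Summing over the conjugates removes the k part and leaves a sum of real
      squares equal to 0.\<close>
    have "0 = (\<Sum>y\<in>B. ev f y)" using zero by simp
    also have "\<dots> = (\<Sum>y\<in>B. (ev (fx s) y - ev (fx t) y)\<^sup>2)"
      by (simp add: f_def sum.distrib sum_subtractf k_def sum_traceless)
    finally have sq: "(ev (fx s) y - ev (fx t) y)\<^sup>2 = 0" if "y \<in> B" for y
      using that finite_B sum_nonneg_eq_0_iff[of B "\<lambda>y. (ev (fx s) y - ev (fx t) y)\<^sup>2"] by auto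
    then have "fx s = fx t" using deg_fx st by (intro ev_eq_on_B_imp_eq) auto
    have "ev (k s) y = ev (k t) y" if "y \<in> B" for y
      using zero[OF that] sq[OF that] by (simp add: f_def)
    then have k: "k s = k t" using deg_k st by (intro ev_eq_on_B_imp_eq) auto
    \<comment> \<open>As \<open>fp\<close> has no constant term, k reveals the subtracted trace and
      so determines \<open>fp\<close>.\<close>
    have "coeff (k s) 0 = - trace (fp s)" "coeff (k t) 0 = - trace (fp t)"
      by (simp_all add: k_def traceless_def fp_def)
    then have "trace (fp s) = trace (fp t)" using k by simp
    then have "smult (int d) (fp s) = smult (int d) (fp t)" using k by (simp add: k_def traceless_def)
    then have "fp s = fp t" using d_pos by (metis smult_cancel of_nat_0_less_iff less_irrefl)
    then have Poly: "Poly (fst s) = Poly (fst t)" "Poly (snd s) = Poly (snd t)"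
      using \<open>fx s = fx t\<close> by (simp_all add: fx_def fp_def)
    have "length (fst s) = length (fst t)" "length (snd s) = length (snd t)"
      using st(1) st(2) by (simp_all add: S1_def S2_def mem_Times_iff)
    with Poly have "fst s = fst t" "snd s = snd t" by (blast intro: Poly_eq_imp_eq)+
    then show "s = t" by (rule prod_eqI)
  qed
  moreover have "finite (S1 \<times> S2)"
    by (auto simp: S1_def S2_def intro: finite_lists_length_eq)
  ultimately have "card (S1 \<times> S2) \<le> IM2 (residue_ring (int q))"
    by (intro card_le_IM2[OF assms(1), where u = "\<lambda>s. poly (fx s) b" and v = "\<lambda>s. poly (k s) b"])
  moreover have "card S1 = A ^ d" "card S2 = (A\<^sup>2) ^ (d - 1)"
    by (simp_all add: S1_def S2_def card_lists_length_eq nat_power_eq del: of_nat_power)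
  ultimately show ?thesis by (simp add: card_cartesian_product)
qed

end

section \<open>Choice of parameters\<close>

theorem mainTheorem4:
  fixes r :: nat
  assumes "prime r" and "r \<ge> 5"
  shows "\<exists>c::real. c > 0 \<and>
           (\<exists>q0::nat. \<forall>q::nat. q \<ge> q0 \<and> prime q \<and>
              ([int q = 1] (mod int r) \<or> [int q = -1] (mod int r)) \<longrightarrow>
              real (IM2 (residue_ring (int q))) \<ge> c * real q powr (3/2 - 2 / (real r - 1)))"
proof -
  have "odd r" using assms prime_odd_nat by auto
  then obtain d where r: "r = 2 * d + 1" by (elim oddE)
  then have d: "d \<ge> 2" using assms by simp
  interpret real_cyclotomic r d using assms r d by unfold_locales auto
  define K :: real where "K = 4 * 4 ^ d + 4 * real d * 2 ^ d"
  have K: "K \<ge> 1"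
  proof -
    have "(4::real) ^ d \<ge> 1" "4 * real d * 2 ^ d \<ge> 0" by simp_all
    then show ?thesis unfolding K_def by linarith
  qed
  \<comment> \<open>With A at most \<open>\<epsilon> * Q\<close>, this makes K A^2 smaller than Q^2,
    whose d-th power is q.\<close>
  define \<epsilon> where "\<epsilon> = 1 / (2 * K)"
  have \<epsilon>: "\<epsilon> > 0" using K by (simp add: \<epsilon>_def)
  have K\<epsilon>: "K * \<epsilon>\<^sup>2 < 1"
  proof -
    have "K * \<epsilon>\<^sup>2 = 1 / (4 * K)" using K by (simp add: \<epsilon>_def power2_eq_square)
    then show ?thesis using K by simp
  qed
  \<comment> \<open>Rounding down to A loses at most a factor 2, and the matching has size
    A^(3d-2).\<close>
  define c where "c = (\<epsilon> / 2) ^ (3 * d - 2)"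
  \<comment> \<open>The 7 serves the root modulo q; the other bound makes
    \<open>\<epsilon> * Q\<close> at least 1.\<close>
  define q0 where "q0 = max 7 (nat \<lceil>(1 / \<epsilon>) ^ (2 * d)\<rceil>)"
  have "real (IM2 (residue_ring (int q))) \<ge> c * real q powr (3/2 - 2 / (real r - 1))"
    if q: "q \<ge> q0" "prime q" "[int q = 1] (mod int r) \<or> [int q = -1] (mod int r)" for q
  proof -
    have q7: "q \<ge> 7" and q_big: "(1 / \<epsilon>) ^ (2 * d) \<le> real q" using q(1) by (auto simp: q0_def)
    have "2 * d + 1 dvd q + 1 \<or> 2 * d + 1 dvd q - 1"
    proof -
      have "int r dvd int q - 1 \<or> int r dvd int q + 1" using q(3) by (simp add: cong_iff_dvd_diff)
      moreover have "int q - 1 = int (q - 1)" "int q + 1 = int (q + 1)" using q7 by auto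
      ultimately show ?thesis unfolding r by (metis of_nat_dvd_iff)
    qed
    then obtain b :: int where b: "int q dvd W b d"
      using exists_root_W_mod_prime[OF q(2) q7 d] by blast
    define Q where "Q = real q powr (1 / (2 * real d))"
    have Q: "Q > 0" using q7 by (simp add: Q_def)
    have Q_pow: "Q ^ n = real q powr (real n / (2 * real d))" for n
      using q7 by (simp add: Q_def powr_powr flip: powr_realpow)
    have Q2d: "Q ^ (2 * d) = real q" using Q_pow[of "2 * d"] d q7 by simp
    have "1 / \<epsilon> \<le> Q"
    proof (rule power_le_imp_le_base)
      have "Suc (2 * d - 1) = 2 * d" using d by simp
      then show "(1 / \<epsilon>) ^ Suc (2 * d - 1) \<le> Q ^ Suc (2 * d - 1)" using q_big Q2d by simp
    qed (use Q in simp)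
    then have \<epsilon>Q: "\<epsilon> * Q \<ge> 1" using \<epsilon> by (simp add: field_simps)
    define A where "A = nat \<lfloor>\<epsilon> * Q\<rfloor>"
    have A: "real A \<le> \<epsilon> * Q" "\<epsilon> * Q / 2 \<le> real A"
    proof -
      have "\<lfloor>\<epsilon> * Q\<rfloor> \<ge> 1" using \<epsilon>Q by simp
      moreover from this have "real A = of_int \<lfloor>\<epsilon> * Q\<rfloor>" by (simp add: A_def)
      ultimately show "real A \<le> \<epsilon> * Q" "\<epsilon> * Q / 2 \<le> real A" by linarith+
    qed
    have "(real A)\<^sup>2 \<le> (\<epsilon> * Q)\<^sup>2" using A by (intro power_mono) auto
    then have "K * (real A)\<^sup>2 \<le> K * (\<epsilon> * Q)\<^sup>2" using K by (intro mult_left_mono) auto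
    also have "\<dots> = (K * \<epsilon>\<^sup>2) * Q\<^sup>2" by (simp add: power_mult_distrib)
    also have "\<dots> < Q\<^sup>2" using K\<epsilon> Q by simp
    finally have "(K * (real A)\<^sup>2) ^ d < (Q\<^sup>2) ^ d" using K d by (intro power_strict_mono) auto
    also have "\<dots> = real q" using Q2d by (simp add: power_mult)
    finally have "A ^ d * (A\<^sup>2) ^ (d - 1) \<le> IM2 (residue_ring (int q))"
      using induced_matching_count[OF q(2) b] by (simp add: K_def)
    moreover have "A ^ d * (A\<^sup>2) ^ (d - 1) = A ^ (3 * d - 2)"
    proof -
      have "3 * d - 2 = d + 2 * (d - 1)" using d by simp
      then show ?thesis by (simp add: power_add power_mult)
    qed
    ultimately have "real A ^ (3 * d - 2) \<le> real (IM2 (residue_ring (int q)))"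
      by (metis of_nat_le_iff of_nat_power)
    moreover have "(\<epsilon> * Q / 2) ^ (3 * d - 2) \<le> real A ^ (3 * d - 2)"
      using A \<epsilon>Q by (intro power_mono) auto
    moreover have "(\<epsilon> * Q / 2) ^ (3 * d - 2) = c * real q powr (3/2 - 2 / (real r - 1))"
    proof -
      \<comment> \<open>Both sides are 3/2 - 1/d, as r - 1 = 2d.\<close>
      have "real (3 * d - 2) / (2 * real d) = 3/2 - 2 / (real r - 1)"
        using d by (simp add: r of_nat_diff field_simps)
      then have "Q ^ (3 * d - 2) = real q powr (3/2 - 2 / (real r - 1))" by (simp only: Q_pow)
      then show ?thesis by (simp add: c_def power_mult_distrib power_divide)
    qed
    ultimately show ?thesis by linarith
  qed
  moreover have "c > 0" using \<epsilon> by (simp add: c_def)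
  ultimately show ?thesis by blast
qed

end
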